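(* For all integers $n\ge 1$, $$F_{n+1}^2=3F_n^2-F^2_{n-1}+2(-1)^n .$$
   Context: The Fibonacci numbers are $F_0=0$, $F_1=1$, $F_n=F_{n-1}+F_{n-2}$ for $n\ge2$. *)

theory Defs
  imports "HOL-Number_Theory.Fib"
begin

end

(* Writing a = F(n-1) and b = F(n), the claim (a + b)^2 = 3 b^2 - a^2 + 2 (-1)^n is twice
   Cassini's identity (a + b) a - b^2 = (-1)^n. *)
theory Submission
  imports Defs
begin

theorem mainTheorem8:
  fixes n :: nat
  assumes "n \<ge> 1"
  shows "(int (fib (n + 1)))\<^sup>2 = 3 * (int (fib n))\<^sup>2 - (int (fib (n - 1)))\<^sup>2 + 2 * (-1) ^ n"
proof -
  \<comment> \<open>Here \<open>n \<ge> 1\<close> matters: with \<open>n = Suc m\<close> the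
    truncated \<open>n - 1\<close> is simply \<open>m\<close>.\<close>
  from assms obtain m where n: "n = Suc m"
    by (cases n) auto
  define a b where "a = int (fib m)" and "b = int (fib (Suc m))"
  \<comment> \<open>Cassini at index \<open>m\<close>, where \<open>a + b\<close> is
    \<open>fib (m + 2)\<close> by the recurrence; the sign is that of
    \<open>m + 1 = n\<close>.\<close>
  have "(a + b) * a - b\<^sup>2 = (-1) ^ n"
    using fib_Cassini_int[of m] by (simp add: n a_def b_def add.commute)
  \<comment> \<open>Expanding, (a + b)^2 - 3 b^2 + a^2 = 2 (a^2 + a b - b^2), which is twice the
    left side of Cassini.\<close>
  then have "(a + b)\<^sup>2 = 3 * b\<^sup>2 - a\<^sup>2 + 2 * (-1) ^ n"
    by (simp add: power2_eq_square algebra_simps)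
  then show ?thesis
    by (simp add: n a_def b_def add.commute)
qed

end
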